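(* Let $q$ be a prime power. If $q$ is odd, there exists a $(q+1,\,q^2-q)$-harc in $\Pi_2(q^2)$. If $q$ is even, there exists a maximal $(q+2,\,q^2-q)$-harc in $\Pi_2(q^2)$.
   Context: $\Pi_2(n)$ denotes the desarguesian projective plane over $GF(n)$. A $k$-arc in $\Pi_2(n)$ is a set of $k$ points no three of which are collinear. Let $\Psi$ be a line of $\Pi_2(n)$, $\mathcal{K}_1$ a set of $k_1$ points in $\Pi_2(n)\setminus\Psi$ and $\mathcal{K}_2$ a set of $k_2$ points in $\Psi$. The set $\mathcal{K}=\mathcal{K}_1\cup\mathcal{K}_2$ is a $(k_1,k_2)$-harc (hierarchical arc) in $\Pi_2(n)$ if: (a) $\mathcal{K}_1$ is a $k_1$-arc in $\Pi_2(n)$; (b) $\mathcal{K}_2$ is a $k_2$-arc in the projective line $\Psi$ (any two of its points are independent, which is automatic); (c) any three points of $\mathcal{K}$ not all contained in $\Psi$ are linearly independent (non-collinear). A $(k_1,k_2)$-harc in $\Pi_2(n)$ is called maximal if it attains the upper bound $k_1+k_2\le n+2$, i.e. if $k_1+k_2=n+2$. *)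

theory Defs
  imports "HOL-Analysis.Analysis" "HOL-Number_Theory.Prime_Powers"
begin

text \<open>
  The desarguesian plane over a finite field \<open>'a\<close>: the projective plane of the vector
  space \<open>'a ^ 3\<close>.  Since the finite field with \<open>n\<close> elements is unique up to isomorphism, this is
  \<open>\<Pi>\<^sub>2(n)\<close> for \<open>n = CARD('a)\<close>.
\<close>

definition pg_points :: "('a::field ^ 3) set set" where
  "pg_points = {P. vec.subspace P \<and> vec.dim P = 1}"

definition pg_lines :: "('a::field ^ 3) set set" where
  "pg_lines = {L. vec.subspace L \<and> vec.dim L = 2}"

definition points_on :: "('a::field ^ 3) set \<Rightarrow> ('a ^ 3) set set" where
  "points_on L = {P \<in> pg_points. P \<subseteq> L}"

definition pg_collinear :: "('a::field ^ 3) set set \<Rightarrow> bool" where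
  "pg_collinear T \<longleftrightarrow> (\<exists>L\<in>pg_lines. T \<subseteq> points_on L)"

text \<open>
  A finite set of projective points is independent if it spans a subspace of (vector space)
  dimension equal to the number of points.
\<close>

definition pg_independent :: "('a::field ^ 3) set set \<Rightarrow> bool" where
  "pg_independent T \<longleftrightarrow> finite T \<and> T \<subseteq> pg_points \<and> vec.dim (vec.span (\<Union>T)) = card T"

definition plane_arc :: "nat \<Rightarrow> ('a::{field,finite} ^ 3) set set \<Rightarrow> bool" where
  "plane_arc k K \<longleftrightarrow> K \<subseteq> pg_points \<and> card K = k \<and>
     (\<forall>T\<subseteq>K. card T = 3 \<longrightarrow> \<not> pg_collinear T)"

definition line_arc :: "nat \<Rightarrow> ('a::{field,finite} ^ 3) set \<Rightarrow> ('a ^ 3) set set \<Rightarrow> bool" where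
  "line_arc k L K \<longleftrightarrow> K \<subseteq> points_on L \<and> card K = k \<and>
     (\<forall>T\<subseteq>K. card T = 2 \<longrightarrow> pg_independent T)"

definition harc :: "nat \<Rightarrow> nat \<Rightarrow> ('a::{field,finite} ^ 3) set set \<Rightarrow> bool" where
  "harc k1 k2 K \<longleftrightarrow> (\<exists>\<Psi>\<in>pg_lines. \<exists>K1 K2.
     K = K1 \<union> K2 \<and> K1 \<subseteq> pg_points - points_on \<Psi> \<and>
     plane_arc k1 K1 \<and> line_arc k2 \<Psi> K2 \<and>
     (\<forall>T\<subseteq>K. card T = 3 \<and> \<not> T \<subseteq> points_on \<Psi> \<longrightarrow> pg_independent T))"

definition maximal_harc :: "nat \<Rightarrow> nat \<Rightarrow> ('a::{field,finite} ^ 3) set set \<Rightarrow> bool" where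
  "maximal_harc k1 k2 K \<longleftrightarrow> harc k1 k2 K \<and> k1 + k2 = CARD('a) + 2"

end

theory Submission
  imports Defs "HOL-Computational_Algebra.Polynomial"
begin

text \<open>
  Let \<open>F\<close> be the field with \<open>q\<^sup>2\<close> elements, and let \<open>U\<close> be the set of its \<open>q + 1\<close> elements of norm
  \<open>u\<^bsup>q+1\<^esup> = 1\<close>. The line \<open>\<Psi>\<close> is the line at infinity \<open>z = 0\<close>. The affine part of the harc consists of
  the points \<open>(u, 1/u, 1)\<close> with \<open>u \<in> U\<close>, which lie on the conic \<open>xy = z\<^sup>2\<close>; when \<open>q\<close> is even, the
  nucleus \<open>(0, 0, 1)\<close> of this conic is added.

  The chord through the points with parameters \<open>u \<noteq> v\<close> meets \<open>z = 0\<close> in the point \<open>(1, -1/(uv), 0)\<close>,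
  and a line through the nucleus and a point with parameter \<open>u\<close> meets it in \<open>(1, 1/u\<^sup>2, 0)\<close>. Since
  \<open>-1\<close> has norm \<open>1\<close>, all these points are of the form \<open>(1, w, 0)\<close> with \<open>w \<in> U\<close>. Hence the remaining
  \<open>(q\<^sup>2 + 1) - (q + 1) = q\<^sup>2 - q\<close> points of \<open>\<Psi>\<close> lie on none of these chords, and together with the affine
  part they form the required harc. (Geometrically, the affine part is a conic, respectively a
  hyperoval, of the Baer subplane \<open>{(t, t\<^sup>q, c) | t \<in> F, c\<^sup>q = c}\<close>, and the \<open>(1, w, 0)\<close> with \<open>w \<in> U\<close> are
  the \<open>q + 1\<close> points of this subplane on an external line.)

  The size of \<open>U\<close> is \<open>card_roots_of_unity_finite_field\<close>, the passage from coordinates to harcs is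
  \<open>harc_affine_points_directions\<close>, and the arithmetic of the chords is in \<open>conic_no_three_collinear\<close>,
  \<open>conic_not_determined\<close>, \<open>nucleus_not_on_secant\<close> and \<open>nucleus_not_determined\<close>.
\<close>

section \<open>Roots of unity in finite fields\<close>

lemma finite_field_power_card_minus_one:
  fixes x :: "'a :: {field,finite}"
  assumes "x \<noteq> 0"
  shows "x ^ (CARD('a) - 1) = 1"
proof -
  \<comment> \<open>multiplication by \<open>x\<close> permutes the factors of the product of all nonzero elements\<close>
  have bij: "bij_betw ((*) x) (UNIV - {0}) (UNIV - {0})"
    by (rule bij_betwI[where g = "\<lambda>y. y / x"]) (use assms in auto)
  have "(\<Prod>y\<in>UNIV - {0}. y) = (\<Prod>y\<in>UNIV - {0}. x * y)"
    using prod.reindex_bij_betw[OF bij, of "\<lambda>y. y"] by simp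
  also have "\<dots> = x ^ card (UNIV - {0::'a}) * (\<Prod>y\<in>UNIV - {0}. y)"
    by (simp add: prod.distrib)
  finally have "x ^ card (UNIV - {0::'a}) * (\<Prod>y\<in>UNIV - {0::'a}. y) = 1 * (\<Prod>y\<in>UNIV - {0}. y)"
    by simp
  moreover have "(\<Prod>y\<in>UNIV - {0::'a}. y) \<noteq> 0"
    by simp
  ultimately show ?thesis
    by (simp add: card_Diff_singleton)
qed

lemma card_power_eq_le:
  fixes c :: "'a :: {field,finite}"
  assumes "d > 0"
  shows "card {x. x ^ d = c} \<le> d"
proof -
  let ?p = "monom 1 d + [:- c:]"
  have deg: "degree ?p = d"
    using assms by (subst degree_add_eq_left) (simp_all add: degree_monom_eq)
  then have "?p \<noteq> 0"
    using assms by auto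
  then have "card {x. poly ?p x = 0} \<le> degree ?p"
    by (rule card_poly_roots_bound)
  then show ?thesis
    by (simp add: deg poly_monom)
qed

text \<open>
  The lower bound holds because \<open>x \<mapsto> x\<^sup>e\<close> maps the \<open>d * e\<close> nonzero elements to \<open>d\<close>-th roots of unity,
  with fibres of size at most \<open>e\<close>.
\<close>

lemma card_roots_of_unity_finite_field:
  assumes "d * e = CARD('a::{field,finite}) - 1"
  shows "card {x :: 'a. x ^ d = 1} = d"
proof (rule antisym)
  have "CARD('a) > 1"
    using card_mono[of "UNIV :: 'a set" "{0, 1}"] by simp
  then have d: "d > 0" and e: "e > 0"
    using assms by (auto intro: Nat.gr0I)
  show "card {x :: 'a. x ^ d = 1} \<le> d"
    by (rule card_power_eq_le[OF d])
  let ?U = "{x :: 'a. x ^ d = 1}"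
  have "x ^ e \<in> ?U" if "x \<noteq> 0" for x :: 'a
    using finite_field_power_card_minus_one[OF that] assms
    by (simp add: mult.commute flip: power_mult)
  then have "UNIV - {0} \<subseteq> (\<Union>u\<in>?U. {x :: 'a. x ^ e = u})"
    by blast
  then have "card (UNIV - {0 :: 'a}) \<le> card (\<Union>u\<in>?U. {x :: 'a. x ^ e = u})"
    by (intro card_mono) auto
  also have "\<dots> \<le> (\<Sum>u\<in>?U. card {x :: 'a. x ^ e = u})"
    by (intro card_UN_le) auto
  also have "\<dots> \<le> (\<Sum>u\<in>?U. e)"
    by (intro sum_mono card_power_eq_le e)
  finally have "d * e \<le> card ?U * e"
    using assms by (simp add: card_Diff_singleton)
  then show "d \<le> card ?U"
    using e by simp
qed

lemma minus_one_eq_one_if_even_card: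
  assumes "even (CARD('a::{field,finite}))"
  shows "(-1 :: 'a) = 1"
proof -
  \<comment> \<open>raise \<open>-1\<close> to the odd power \<open>CARD('a) - 1\<close>\<close>
  have "odd (CARD('a) - 1)"
    using assms by (simp add: zero_less_card_finite)
  then show ?thesis
    using finite_field_power_card_minus_one[of "-1 :: 'a"] by simp
qed

section \<open>Points in homogeneous coordinates\<close>

text \<open>
  The projective point with homogeneous coordinates \<open>(a : b : c)\<close>; for \<open>a = b = c = 0\<close> it is the
  zero subspace, which is not a point.
\<close>

definition pt :: "'a::field \<Rightarrow> 'a \<Rightarrow> 'a \<Rightarrow> ('a ^ 3) set" where
  "pt a b c = vec.span {vector [a, b, c]}"

lemma vector_3_eq_0_iff: "(vector [a, b, c] :: 'a::field ^ 3) = 0 \<longleftrightarrow> a = 0 \<and> b = 0 \<and> c = 0"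
  by (simp add: vec_eq_iff forall_3)

lemma pt_in_pg_points:
  assumes "a \<noteq> 0 \<or> b \<noteq> 0 \<or> c \<noteq> 0"
  shows "pt a b c \<in> pg_points"
proof -
  have "vec.independent {vector [a, b, c] :: 'a ^ 3}"
    using assms by (simp add: vec.independent_insert vector_3_eq_0_iff vec.span_empty)
  from vec.dim_span_eq_card_independent[OF this]
  show ?thesis
    by (simp add: pg_points_def pt_def)
qed

lemma pt_eqD:
  assumes "pt a b c = pt a' b' c'"
  shows "\<exists>k. a = k * a' \<and> b = k * b' \<and> c = k * c'"
proof -
  have "vector [a, b, c] \<in> vec.span {vector [a', b', c'] :: 'a ^ 3}"
    using vec.span_base[of "vector [a, b, c]" "{vector [a, b, c] :: 'a ^ 3}"]
    unfolding assms[unfolded pt_def] by simp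
  then obtain k where "vector [a, b, c] = k *s (vector [a', b', c'] :: 'a ^ 3)"
    by (auto simp: vec.span_singleton)
  then show ?thesis
    by (auto simp: vec_eq_iff forall_3)
qed

text \<open>The first assumption says that the determinant of the three coordinate vectors is nonzero.\<close>

lemma pg_independent_pts:
  fixes a1 :: "'a :: field"
  assumes det: "a1 * (b2 * c3 - b3 * c2) - b1 * (a2 * c3 - a3 * c2) + c1 * (a2 * b3 - a3 * b2) \<noteq> 0"
    and card: "card {pt a1 b1 c1, pt a2 b2 c2, pt a3 b3 c3} = 3"
  shows "pg_independent {pt a1 b1 c1, pt a2 b2 c2, pt a3 b3 c3}" (is "pg_independent ?T")
proof -
  let ?A = "vector [vector [a1, b1, c1], vector [a2, b2, c2], vector [a3, b3, c3]] :: 'a ^ 3 ^ 3"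
  have "det ?A \<noteq> 0"
    using det by (simp add: det_3 algebra_simps)
  then have "invertible ?A"
    by (simp add: invertible_det_nz)
  then have rows: "vec.span (rows ?A) = UNIV"
    by (auto simp: invertible_def simp flip: matrix_left_invertible_span_rows_gen)
  have "rows ?A = range (($) ?A)"
    by (auto simp: rows_def row_def vec_lambda_eta)
  then have "rows ?A \<subseteq> \<Union>?T"
    by (simp add: UNIV_3 pt_def vec.span_base)
  then have "vec.span (\<Union>?T) = UNIV"
    using vec.span_mono[of "rows ?A" "\<Union>?T"] rows by auto
  moreover have "?T \<subseteq> pg_points"
    using det by (auto intro!: pt_in_pg_points)
  ultimately show ?thesis
    using card by (simp add: pg_independent_def vec_dim_card del: vec.dim_UNIV)
qed

lemma pg_independent_3_not_collinear:
  assumes "pg_independent T" "card T = 3"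
  shows "\<not> pg_collinear T"
proof
  assume "pg_collinear T"
  then obtain L where L: "vec.subspace L" "vec.dim L = 2" "\<Union>T \<subseteq> L"
    by (auto simp: pg_collinear_def pg_lines_def points_on_def)
  have "vec.dim (vec.span (\<Union>T)) \<le> vec.dim L"
    by (intro vec.dim_subset vec.span_minimal L)
  then show False
    using L assms by (simp add: pg_independent_def)
qed

lemma pg_independent_2:
  assumes "card T = 2" "T \<subseteq> pg_points"
  shows "pg_independent T"
proof -
  obtain P Q where T: "T = {P, Q}" "P \<noteq> Q"
    using assms by (auto simp: card_2_iff)
  have P: "vec.subspace P" "vec.dim P = 1" and Q: "vec.subspace Q" "vec.dim Q = 1"
    using assms T by (auto simp: pg_points_def)
  let ?S = "vec.span (P \<union> Q)"
  have sub: "P \<subseteq> ?S" "Q \<subseteq> ?S"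
    using vec.span_superset[of "P \<union> Q"] by auto
  have "vec.dim ?S \<noteq> 1"
    using vec.subspace_dim_equal[OF P(1) vec.subspace_span sub(1)]
      vec.subspace_dim_equal[OF Q(1) vec.subspace_span sub(2)] P Q T by auto
  moreover have "vec.dim ?S \<ge> 1"
    using vec.dim_subset[OF sub(1)] P by simp
  moreover have "vec.dim ?S \<le> 2"
    using vec.dim_sums_Int[OF P(1) Q(1)] P Q vec.span_Un[of P Q]
    by (simp add: vec.span_eq_iff[THEN iffD2])
  ultimately show ?thesis
    using assms T by (simp add: pg_independent_def)
qed

section \<open>Harcs from affine points and directions\<close>

lemma card_3_obtain_others:
  assumes "card T = 3" "X \<in> T"
  obtains Y Z where "T = {X, Y, Z}" "X \<noteq> Y" "X \<noteq> Z" "Y \<noteq> Z"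
  using assms by (auto simp: card_3_iff insert_commute)

lemma line_at_infinity_in_pg_lines: "{v :: 'a::field ^ 3. v $ 3 = 0} \<in> pg_lines"
proof -
  let ?L = "{v :: 'a ^ 3. v $ 3 = 0}"
  have sub: "vec.subspace ?L"
    by (auto simp: vec.subspace_def)
  let ?e1 = "vector [1, 0, 0] :: 'a ^ 3" and ?e2 = "vector [0, 1, 0] :: 'a ^ 3"
  have ne: "?e1 \<noteq> ?e2"
    by (simp add: vec_eq_iff forall_3)
  have "vec.independent {?e1, ?e2}"
    by (auto simp: vec.independent_insert vec.span_singleton vec_eq_iff forall_3)
  moreover have "?L \<subseteq> vec.span {?e1, ?e2}"
  proof
    fix v :: "'a ^ 3" assume "v \<in> ?L"
    then have "v = v $ 1 *s ?e1 + v $ 2 *s ?e2"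
      by (simp add: vec_eq_iff forall_3)
    also have "\<dots> \<in> vec.span {?e1, ?e2}"
      by (intro vec.span_add vec.span_scale vec.span_base) auto
    finally show "v \<in> vec.span {?e1, ?e2}" .
  qed
  moreover have "{?e1, ?e2} \<subseteq> ?L"
    by simp
  ultimately have "vec.dim ?L = 2"
    using vec.dim_unique[of "{?e1, ?e2}" ?L 2] ne by simp
  then show ?thesis
    using sub by (simp add: pg_lines_def)
qed

lemma pt_subset_line_at_infinity_iff: "pt (a::'a::field) b c \<subseteq> {v. v $ 3 = 0} \<longleftrightarrow> c = 0"
proof -
  have "pt a b c = range (\<lambda>k. k *s vector [a, b, c])"
    by (simp add: pt_def vec.span_singleton)
  moreover have "1 *s vector [a, b, c] \<in> range (\<lambda>k. k *s (vector [a, b, c] :: 'a ^ 3))"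
    by (rule rangeI)
  ultimately show ?thesis
    by (auto simp: subset_iff)
qed

text \<open>
  The affine point \<open>(a, b)\<close> stands for \<open>(a : b : 1)\<close>, the direction \<open>(x, y)\<close> for the point \<open>(x : y : 0)\<close>
  at infinity. If \<open>A\<close> has no three collinear points, distinct elements of \<open>D\<close> are non-proportional,
  and no element of \<open>D\<close> is the direction of a chord of \<open>A\<close>, then \<open>A\<close> and \<open>D\<close> form a harc: three points
  not all at infinity include one of \<open>A\<close>, and each distribution of the other two is excluded from
  being collinear by one of these conditions.
\<close>

lemma harc_affine_points_directions:
  fixes A D :: "('a::{field,finite} \<times> 'a) set"
  assumes no_three_collinear: "\<And>a b c d e f. (a, b) \<in> A \<Longrightarrow> (c, d) \<in> A \<Longrightarrow> (e, f) \<in> A \<Longrightarrow>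
      (a, b) \<noteq> (c, d) \<Longrightarrow> (a, b) \<noteq> (e, f) \<Longrightarrow> (c, d) \<noteq> (e, f) \<Longrightarrow>
      (c - a) * (f - b) \<noteq> (e - a) * (d - b)"
    and directions: "(0, 0) \<notin> D"
    and distinct_directions: "\<And>x y x' y'. (x, y) \<in> D \<Longrightarrow> (x', y') \<in> D \<Longrightarrow>
      (x, y) \<noteq> (x', y') \<Longrightarrow> x * y' \<noteq> x' * y"
    and not_determined: "\<And>a b c d x y. (a, b) \<in> A \<Longrightarrow> (c, d) \<in> A \<Longrightarrow> (a, b) \<noteq> (c, d) \<Longrightarrow>
      (x, y) \<in> D \<Longrightarrow> (c - a) * y \<noteq> (d - b) * x"
  shows "\<exists>K :: ('a ^ 3) set set. harc (card A) (card D) K"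
proof -
  let ?L = "{v :: 'a ^ 3. v $ 3 = 0}"
  define K1 where "K1 = (\<lambda>(a, b). pt a b 1) ` A"
  define K2 where "K2 = (\<lambda>(x, y). pt x y 0) ` D"
  have K1: "K1 \<subseteq> pg_points - points_on ?L"
    by (auto simp: K1_def points_on_def pt_subset_line_at_infinity_iff intro!: pt_in_pg_points)
  have K2: "K2 \<subseteq> points_on ?L"
  proof
    fix P assume "P \<in> K2"
    then obtain x y where P: "P = pt x y 0" "(x, y) \<in> D"
      by (auto simp: K2_def)
    then have "x \<noteq> 0 \<or> y \<noteq> 0 \<or> (0 :: 'a) \<noteq> 0"
      using directions by auto
    then show "P \<in> points_on ?L"
      unfolding points_on_def mem_Collect_eq P pt_subset_line_at_infinity_iff
      by (simp add: pt_in_pg_points)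
  qed
  have "inj_on (\<lambda>(a, b). pt a b 1) A"
    by (auto simp: inj_on_def dest!: pt_eqD)
  then have card_K1: "card K1 = card A"
    by (simp add: K1_def card_image)
  have "inj_on (\<lambda>(x, y). pt x y 0) D"
  proof (rule inj_onI, clarify, rule ccontr)
    fix x y x' y' assume "(x, y) \<in> D" "(x', y') \<in> D" "pt x y 0 = pt x' y' 0"
      and "\<not> (x = x' \<and> y = y')"
    then show False
      using distinct_directions[of x y x' y'] by (auto dest!: pt_eqD)
  qed
  then have card_K2: "card K2 = card D"
    by (simp add: K2_def card_image)
  have two_affine: "pg_independent {X, Y, Z}"
    if XYZ: "X \<in> K1" "Y \<in> K1" "Z \<in> K2" and card: "card {X, Y, Z} = 3" for X Y Z
  proof -
    obtain a b c d x y where *: "(a, b) \<in> A" "(c, d) \<in> A" "(x, y) \<in> D"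
      "X = pt a b 1" "Y = pt c d 1" "Z = pt x y 0"
      using XYZ by (auto simp: K1_def K2_def)
    have "(a, b) \<noteq> (c, d)"
      using card * by (auto simp: card_insert_if split: if_splits)
    then have "(c - a) * y \<noteq> (d - b) * x"
      using not_determined * by blast
    then show ?thesis
      unfolding * using card[unfolded *]
      by (intro pg_independent_pts) (auto simp: algebra_simps)
  qed
  have indep: "pg_independent T"
    if T: "T \<subseteq> K1 \<union> K2" "card T = 3" "\<not> T \<subseteq> points_on ?L" for T
  proof -
    obtain X where "X \<in> T" "X \<in> K1"
      using T K2 by blast
    with card_3_obtain_others[OF T(2)] obtain Y Z where
      XYZ: "T = {X, Y, Z}" "X \<noteq> Y" "X \<noteq> Z" "Y \<noteq> Z" by metis
    then have "Y \<in> K1 \<union> K2" "Z \<in> K1 \<union> K2"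
      using T by auto
    then consider "Y \<in> K1" "Z \<in> K1" | "Y \<in> K1" "Z \<in> K2" | "Z \<in> K1" "Y \<in> K2"
      | "Y \<in> K2" "Z \<in> K2"
      by blast
    then show ?thesis
    proof cases
      case 1
      obtain a b c d e f where *: "(a, b) \<in> A" "(c, d) \<in> A" "(e, f) \<in> A"
        "X = pt a b 1" "Y = pt c d 1" "Z = pt e f 1"
        using 1 \<open>X \<in> K1\<close> by (auto simp: K1_def)
      have "(c - a) * (f - b) \<noteq> (e - a) * (d - b)"
        by (rule no_three_collinear) (use * XYZ in auto)
      then show ?thesis
        unfolding XYZ(1) * using T(2)[unfolded XYZ(1) *]
        by (intro pg_independent_pts) (auto simp: algebra_simps)
    next
      case 2
      then show ?thesis
        using two_affine[of X Y Z] \<open>X \<in> K1\<close> T XYZ by simp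
    next
      case 3
      have "T = {X, Z, Y}"
        using XYZ by auto
      then show ?thesis
        using two_affine[of X Z Y] 3 \<open>X \<in> K1\<close> T by simp
    next
      case 4
      obtain a b x y x' y' where *: "(a, b) \<in> A" "(x, y) \<in> D" "(x', y') \<in> D"
        "X = pt a b 1" "Y = pt x y 0" "Z = pt x' y' 0"
        using 4 \<open>X \<in> K1\<close> by (auto simp: K1_def K2_def)
      have "x * y' \<noteq> x' * y"
        by (rule distinct_directions) (use * XYZ in auto)
      then show ?thesis
        unfolding XYZ(1) * using T(2)[unfolded XYZ(1) *]
        by (intro pg_independent_pts) (auto simp: algebra_simps)
    qed
  qed
  have "plane_arc (card A) K1"
    unfolding plane_arc_def
  proof (intro conjI allI impI)
    fix T assume T: "T \<subseteq> K1" "card T = 3"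
    then have "T \<noteq> {}"
      by auto
    then have "\<not> T \<subseteq> points_on ?L"
      using T K1 by blast
    then have "pg_independent T"
      using T by (intro indep) auto
    then show "\<not> pg_collinear T"
      using pg_independent_3_not_collinear T by blast
  qed (use K1 card_K1 in auto)
  moreover have "line_arc (card D) ?L K2"
    unfolding line_arc_def using K2 card_K2
    by (auto intro!: pg_independent_2 simp: points_on_def)
  ultimately have "harc (card A) (card D) (K1 \<union> K2)"
    unfolding harc_def
    by (intro bexI[OF _ line_at_infinity_in_pg_lines] exI[of _ K1] exI[of _ K2])
       (use K1 indep in auto)
  then show ?thesis
    by blast
qed

section \<open>The conic and the directions of its chords\<close>

text \<open>
  Over the field with \<open>q\<^sup>2\<close> elements, these are the elements whose norm to the subfield with \<open>q\<close>
  elements is \<open>1\<close>.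
\<close>

definition norm_one :: "nat \<Rightarrow> 'a::field set" where
  "norm_one q = {u. u ^ (q + 1) = 1}"

text \<open>The affine points of the hyperbola \<open>xy = 1\<close> whose first coordinate has norm \<open>1\<close>.\<close>

definition conic_points :: "nat \<Rightarrow> ('a::field \<times> 'a) set" where
  "conic_points q = (\<lambda>u. (u, inverse u)) ` norm_one q"

text \<open>
  The directions other than those of slope in \<open>norm_one q\<close>, one representative for each: \<open>(1, w)\<close> for
  slope \<open>w\<close>, and \<open>(0, 1)\<close> for the vertical direction.
\<close>

definition norm_one_free_directions :: "nat \<Rightarrow> ('a::field \<times> 'a) set" where
  "norm_one_free_directions q = insert (0, 1) (Pair 1 ` (- norm_one q))"

lemma norm_one_nonzero: "u \<in> norm_one q \<Longrightarrow> u \<noteq> 0"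
  by (auto simp: norm_one_def)

lemma card_norm_one:
  assumes "CARD('a::{field,finite}) = q ^ 2"
  shows "card (norm_one q :: 'a set) = q + 1"
proof -
  have "(q + 1) * (q - 1) = CARD('a) - 1"
    using assms by (simp add: algebra_simps power2_eq_square diff_mult_distrib2)
  then show ?thesis
    unfolding norm_one_def by (rule card_roots_of_unity_finite_field)
qed

lemma card_conic_points:
  assumes "CARD('a::{field,finite}) = q ^ 2"
  shows "card (conic_points q :: ('a \<times> 'a) set) = q + 1"
  unfolding conic_points_def
  by (subst card_image) (auto simp: inj_on_def card_norm_one[OF assms])

lemma card_norm_one_free_directions:
  assumes "CARD('a::{field,finite}) = q ^ 2"
  shows "card (norm_one_free_directions q :: ('a \<times> 'a) set) = q ^ 2 - q"
proof -
  have "card (norm_one q :: 'a set) \<le> CARD('a)"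
    by (intro card_mono) auto
  then have "q + 1 \<le> q ^ 2"
    using assms card_norm_one[OF assms] by simp
  moreover have "card (Pair (1 :: 'a) ` (- norm_one q :: 'a set)) = q ^ 2 - (q + 1)"
    unfolding Compl_eq_Diff_UNIV
    by (subst card_image) (simp_all only: inj_on_def prod.inject card_Diff_subset finite subset_UNIV
      card_norm_one[OF assms] assms, simp)
  moreover have "(0, 1) \<notin> Pair (1 :: 'a) ` (- norm_one q :: 'a set)"
    by auto
  ultimately show ?thesis
    by (simp add: norm_one_free_directions_def)
qed

lemma norm_one_free_directions_distinct:
  assumes "(x, y) \<in> norm_one_free_directions q" "(x', y') \<in> norm_one_free_directions q"
    and "(x, y) \<noteq> (x', y')"
  shows "x * y' \<noteq> x' * y"
  using assms by (auto simp: norm_one_free_directions_def)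

lemma minus_one_power_norm:
  assumes "CARD('a::{field,finite}) = q ^ 2"
  shows "(-1 :: 'a) ^ (q + 1) = 1"
proof (cases "even q")
  case True
  then have "even (CARD('a))"
    using assms by simp
  then show ?thesis
    by (simp only: minus_one_eq_one_if_even_card power_one)
qed simp

lemma norm_one_free_directionD:
  assumes "(x, y) \<in> norm_one_free_directions q" "w \<in> norm_one q"
  shows "y \<noteq> w * x"
  using assms by (auto simp: norm_one_free_directions_def)

lemma conic_no_three_collinear:
  fixes a :: "'a::field"
  assumes "(a, b) \<in> conic_points q" "(c, d) \<in> conic_points q" "(e, f) \<in> conic_points q"
    and "(a, b) \<noteq> (c, d)" "(a, b) \<noteq> (e, f)" "(c, d) \<noteq> (e, f)"
  shows "(c - a) * (f - b) \<noteq> (e - a) * (d - b)"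
proof
  assume eq: "(c - a) * (f - b) = (e - a) * (d - b)"
  have nz: "a \<noteq> 0" "c \<noteq> 0" "e \<noteq> 0"
    and inv: "b = inverse a" "d = inverse c" "f = inverse e"
    using assms by (auto simp: conic_points_def dest: norm_one_nonzero)
  have ne: "a \<noteq> c" "a \<noteq> e" "c \<noteq> e"
    using assms inv by auto
  \<comment> \<open>up to the factor \<open>ace\<close>, the determinant is a Vandermonde determinant\<close>
  have "(c - a) * (f - b) - (e - a) * (d - b) = (c - a) * (e - a) * (e - c) / (a * c * e)"
    using nz by (simp add: inv field_simps)
  then show False
    using eq ne nz by simp
qed

text \<open>The chord through the points with parameters \<open>a \<noteq> c\<close> has slope \<open>-1/(ac)\<close>, of norm \<open>1\<close>.\<close>

lemma conic_not_determined:
  fixes a :: "'a::{field,finite}"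
  assumes card: "CARD('a) = q ^ 2"
    and "(a, b) \<in> conic_points q" "(c, d) \<in> conic_points q" "(a, b) \<noteq> (c, d)"
    and "(x, y) \<in> norm_one_free_directions q"
  shows "(c - a) * y \<noteq> (d - b) * x"
proof
  assume eq: "(c - a) * y = (d - b) * x"
  have a: "a \<in> norm_one q" "b = inverse a" "a \<noteq> 0" and c: "c \<in> norm_one q" "d = inverse c" "c \<noteq> 0"
    using assms by (auto simp: conic_points_def dest: norm_one_nonzero)
  have "c - a \<noteq> 0"
    using assms a c by auto
  moreover have "(c - a) * y = (c - a) * ((-1) * inverse (a * c) * x)"
    unfolding eq a(2) c(2) using a(3) c(3) by (simp add: field_simps)
  ultimately have "y = (-1) * inverse (a * c) * x"
    by (metis mult_left_cancel)
  moreover have "(-1) * inverse (a * c) \<in> norm_one q"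
    using a(1) c(1) minus_one_power_norm[OF card]
    unfolding norm_one_def mem_Collect_eq power_mult_distrib power_inverse by simp
  ultimately show False
    using norm_one_free_directionD assms by blast
qed

section \<open>The nucleus in characteristic two\<close>

lemma square_eq_iff_char_2:
  fixes x y :: "'a::field"
  assumes "(-1 :: 'a) = 1"
  shows "x * x = y * y \<longleftrightarrow> x = y"
  by (metis assms mult_minus1 mult_1 square_eq_iff)

text \<open>
  No chord of the conic passes through the nucleus \<open>(0, 0)\<close>: the points with parameters \<open>a\<close> and \<open>c\<close>
  are collinear with it only if \<open>a\<^sup>2 = c\<^sup>2\<close>.
\<close>

lemma nucleus_not_on_secant:
  fixes a :: "'a::field"
  assumes char: "(-1 :: 'a) = 1"
    and "(a, b) \<in> conic_points q" "(c, d) \<in> conic_points q" "(a, b) \<noteq> (c, d)"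
  shows "a * d \<noteq> c * b"
proof
  assume eq: "a * d = c * b"
  have nz: "a \<noteq> 0" "c \<noteq> 0" and inv: "b = inverse a" "d = inverse c"
    using assms by (auto simp: conic_points_def dest: norm_one_nonzero)
  have "a * a = c * c"
    using eq nz unfolding inv by (simp add: field_simps)
  moreover have "a \<noteq> c"
    using assms inv by auto
  ultimately show False
    using square_eq_iff_char_2[OF char] by blast
qed

text \<open>The line through the nucleus and the point with parameter \<open>a\<close> has slope \<open>1/a\<^sup>2\<close>, of norm \<open>1\<close>.\<close>

lemma nucleus_not_determined:
  fixes a :: "'a::field"
  assumes "(a, b) \<in> conic_points q" "(x, y) \<in> norm_one_free_directions q"
  shows "a * y \<noteq> b * x"
proof
  assume eq: "a * y = b * x"
  have a: "a \<in> norm_one q" "a \<noteq> 0" "b = inverse a"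
    using assms by (auto simp: conic_points_def dest: norm_one_nonzero)
  then have "y = inverse (a * a) * x"
    using eq by (simp add: field_simps)
  moreover have "inverse (a * a) \<in> norm_one q"
    using a(1) unfolding norm_one_def mem_Collect_eq power_mult_distrib power_inverse by simp
  ultimately show False
    using norm_one_free_directionD assms by blast
qed

section \<open>Existence of the harcs\<close>

theorem theorem5p4:
  fixes q :: nat
  assumes "primepow q"
    and "CARD('a::{field,finite}) = q ^ 2"
  shows "(odd q \<longrightarrow> (\<exists>K :: ('a ^ 3) set set. harc (q + 1) (q ^ 2 - q) K)) \<and>
         (even q \<longrightarrow> (\<exists>K :: ('a ^ 3) set set. maximal_harc (q + 2) (q ^ 2 - q) K))"
proof (intro conjI impI)
  let ?C = "conic_points q :: ('a \<times> 'a) set"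
  let ?D = "norm_one_free_directions q :: ('a \<times> 'a) set"
  have D0: "(0, 0) \<notin> ?D"
    by (auto simp: norm_one_free_directions_def)
  have "\<exists>K :: ('a ^ 3) set set. harc (card ?C) (card ?D) K"
    by (rule harc_affine_points_directions)
       (use D0 in \<open>blast dest: conic_no_three_collinear norm_one_free_directions_distinct
          conic_not_determined[OF assms(2)]\<close>)+
  then show "\<exists>K :: ('a ^ 3) set set. harc (q + 1) (q ^ 2 - q) K"
    by (simp add: card_conic_points card_norm_one_free_directions assms(2))
next
  assume "even q"
  let ?C = "conic_points q :: ('a \<times> 'a) set"
  let ?A = "insert (0, 0) ?C"
  let ?D = "norm_one_free_directions q :: ('a \<times> 'a) set"
  have char: "(-1 :: 'a) = 1"
    using \<open>even q\<close> assms by (intro minus_one_eq_one_if_even_card) simp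
  have D0: "(0, 0) \<notin> ?D"
    by (auto simp: norm_one_free_directions_def)
  have C0: "(0, 0) \<notin> ?C"
    by (auto simp: conic_points_def dest: norm_one_nonzero)
  have "\<exists>K :: ('a ^ 3) set set. harc (card ?A) (card ?D) K"
  proof (rule harc_affine_points_directions)
    fix a b c d e f :: 'a
    assume A: "(a, b) \<in> ?A" "(c, d) \<in> ?A" "(e, f) \<in> ?A"
      and ne: "(a, b) \<noteq> (c, d)" "(a, b) \<noteq> (e, f)" "(c, d) \<noteq> (e, f)"
    consider "(a, b) = (0, 0)" "(c, d) \<in> ?C" "(e, f) \<in> ?C"
      | "(c, d) = (0, 0)" "(a, b) \<in> ?C" "(e, f) \<in> ?C"
      | "(e, f) = (0, 0)" "(a, b) \<in> ?C" "(c, d) \<in> ?C"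
      | "(a, b) \<in> ?C" "(c, d) \<in> ?C" "(e, f) \<in> ?C"
      using A ne by blast
    then show "(c - a) * (f - b) \<noteq> (e - a) * (d - b)"
    proof cases
      case 1
      then show ?thesis
        using nucleus_not_on_secant[OF char 1(2,3)] ne by simp
    next
      case 2
      then show ?thesis
        using nucleus_not_on_secant[OF char 2(2,3)] ne by (auto simp: algebra_simps)
    next
      case 3
      then show ?thesis
        using nucleus_not_on_secant[OF char 3(2,3)] ne by (auto simp: algebra_simps)
    next
      case 4
      then show ?thesis
        using conic_no_three_collinear ne by blast
    qed
  next
    fix a b c d x y :: 'a
    assume A: "(a, b) \<in> ?A" "(c, d) \<in> ?A" "(a, b) \<noteq> (c, d)" and D: "(x, y) \<in> ?D"
    consider "(a, b) = (0, 0)" "(c, d) \<in> ?C" | "(c, d) = (0, 0)" "(a, b) \<in> ?C"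
      | "(a, b) \<in> ?C" "(c, d) \<in> ?C"
      using A by blast
    then show "(c - a) * y \<noteq> (d - b) * x"
    proof cases
      case 1
      then show ?thesis
        using nucleus_not_determined[OF 1(2) D] by simp
    next
      case 2
      then show ?thesis
        using nucleus_not_determined[OF 2(2) D] by simp
    next
      case 3
      then show ?thesis
        using conic_not_determined[OF assms(2)] A D by blast
    qed
  qed (use D0 norm_one_free_directions_distinct in blast)+
  then have "\<exists>K :: ('a ^ 3) set set. harc (q + 2) (q ^ 2 - q) K"
    using C0 by (simp add: card_conic_points card_norm_one_free_directions assms(2))
  moreover have "q \<le> q ^ 2"
    by (simp add: power2_eq_square)
  ultimately show "\<exists>K :: ('a ^ 3) set set. maximal_harc (q + 2) (q ^ 2 - q) K"
    by (auto simp: maximal_harc_def assms(2))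
qed

end
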